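(* Let $\lambda\in(0,1/2]$. There is a constant $c_\lambda>0$, depending only on $\lambda$, for which the following holds. Let $n$ be a positive integer such that $d=\lambda n$ is an integer, and let $A$ be chosen uniformly at random from $\mathcal{M}_{n,d}$. Then $$\sup_{x\in\mathbb{S}_0^{n-1}}\mathbb{P}[\|Ax\|_2\le c_\lambda\sqrt{n}]\le 2e^{-c_\lambda n}.$$
   Context: $\mathcal{M}_{n,d}$ is the set of all $n\times n$ matrices with entries in $\{0,1\}$ with every row and column summing to $d$. $\mathbb{S}_0^{n-1}$ is the set of Euclidean unit vectors $x\in\mathbb{R}^n$ with $\sum_{i=1}^n x_i=0$. *)

theory Defs
  imports "HOL-Probability.Probability_Mass_Function" "Jordan_Normal_Form.Matrix"
begin

text \<open>
  The constant in the theorem is uniform in the dimension, so the dimension has to be a term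
  rather than a type; hence the matrices and vectors with explicit dimension of
  Jordan_Normal_Form (indices start at 0) instead of those of HOL-Analysis, whose
  notation is switched off.
\<close>

no_notation Finite_Cartesian_Product.vec_nth (infixl \<open>$\<close> 90)

definition regular_mats :: "nat \<Rightarrow> nat \<Rightarrow> real mat set" where
  "regular_mats n d = {A \<in> carrier_mat n n.
     (\<forall>i<n. \<forall>j<n. A $$ (i, j) \<in> {0, 1}) \<and>
     (\<forall>i<n. (\<Sum>j<n. A $$ (i, j)) = real d) \<and>
     (\<forall>j<n. (\<Sum>i<n. A $$ (i, j)) = real d)}"

definition norm2_vec :: "real Matrix.vec \<Rightarrow> real" where
  "norm2_vec v = L2_set (\<lambda>i. v $ i) {..<dim_vec v}"

definition sphere0 :: "nat \<Rightarrow> real Matrix.vec set" where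
  "sphere0 n = {x \<in> carrier_vec n. norm2_vec x = 1 \<and> (\<Sum>i<n. x $ i) = 0}"

text \<open>
  The next two lemmas make \<open>pmf_of_set (regular_mats n d)\<close> the uniform distribution; the third
  rules out a supremum over the empty set.
\<close>

lemma finite_regular_mats: "finite (regular_mats n d)"
proof (rule finite_subset)
  let ?F = "PiE ({..<n} \<times> {..<n}) (\<lambda>_. {0, 1 :: real})"
  show "finite (mat n n ` ?F)" by (intro finite_imageI finite_PiE) auto
  show "regular_mats n d \<subseteq> mat n n ` ?F"
  proof
    fix A assume A: "A \<in> regular_mats n d"
    let ?f = "restrict (\<lambda>p. A $$ p) ({..<n} \<times> {..<n})"
    have "A = mat n n ?f" using A by (intro eq_matI) (auto simp: regular_mats_def)
    moreover have "?f \<in> ?F" using A by (auto simp: regular_mats_def)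
    ultimately show "A \<in> mat n n ` ?F" by blast
  qed
qed

lemma regular_mats_nonempty:
  assumes "d \<le> n" shows "regular_mats n d \<noteq> {}"
proof -
  let ?A = "mat n n (\<lambda>(i, j). if (i + j) mod n < d then 1 else 0 :: real)"
  have row: "(\<Sum>j<n. if (i + j) mod n < d then 1 else 0 :: real) = real d" if "i < n" for i
  proof -
    have shift: "(i + j) mod n = (if i + j < n then i + j else i + j - n)" if "j < n" for j
      using \<open>i < n\<close> that by (simp add: mod_if)
    have inj: "inj_on (\<lambda>j. (i + j) mod n) {..<n}"
      by (rule inj_onI) (auto simp: shift split: if_splits)
    have "(\<lambda>j. (i + j) mod n) ` {..<n} = {..<n}"
      using that by (intro card_subset_eq) (auto simp: card_image[OF inj])
    then have "(\<Sum>j<n. if (i + j) mod n < d then 1 else 0 :: real)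
               = (\<Sum>k<n. if k < d then 1 else 0)"
      using sum.reindex[OF inj, of "\<lambda>k. if k < d then 1 else 0 :: real"] by simp
    also have "\<dots> = real (card {k. k < n \<and> k < d})"
      by (simp add: sum.If_cases lessThan_def Int_def)
    also have "{k. k < n \<and> k < d} = {..<d}" using assms by auto
    finally show ?thesis by simp
  qed
  have "?A \<in> regular_mats n d"
    using row by (auto simp: regular_mats_def) (simp add: add.commute)
  then show ?thesis by blast
qed

lemma sphere0_nonempty:
  assumes "n \<ge> 2" shows "sphere0 n \<noteq> {}"
proof -
  let ?f = "\<lambda>i. if i = 0 then 1 / sqrt 2 else if i = 1 then - (1 / sqrt 2) else 0 :: real"
  have split: "(\<Sum>i<n. g i) = g 0 + g 1" if "\<And>i. i \<ge> 2 \<Longrightarrow> g i = 0" for g :: "nat \<Rightarrow> real"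
  proof -
    have "(\<Sum>i<n. g i) = (\<Sum>i<2. g i)"
      using assms that by (intro sum.mono_neutral_right) auto
    then show ?thesis by (simp add: numeral_2_eq_2)
  qed
  have "(\<Sum>i<n. ?f i) = 0" using split[of ?f] by simp
  moreover have "(\<Sum>i<n. (?f i)\<^sup>2) = 1"
    using split[of "\<lambda>i. (?f i)\<^sup>2"] by (simp add: power_divide)
  ultimately have "Matrix.vec n ?f \<in> sphere0 n"
    by (simp add: sphere0_def norm2_vec_def L2_set_def)
  then show ?thesis by blast
qed

end

theory Submission
  imports Defs
begin

text \<open>
  Bound the average of \<open>exp (- \<parallel>A x\<parallel>\<^sup>2)\<close> over \<open>\<M>\<close>. Given two rows, a matching of the
  columns and a set of matched pairs, flipping the selected \<open>2 \<times> 2\<close> blocks that are permutation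
  matrices is an involution of \<open>\<M>\<close>. Under random flips, the entry of \<open>A x\<close> in the first
  row is a shifted Rademacher sum, so by comparing second and fourth moments the average of
  \<open>exp (- (A x)\<^sub>i\<^sup>2)\<close> drops by an amount proportional to the sum of \<open>(x\<^sub>j - x\<^sub>k)\<^sup>2\<close> over the
  flippable pairs (the energy of the two rows). For every fixed \<open>A\<close>, the energy averaged over
  all pairs of rows is at least of order \<open>\<lambda>\<^sup>2\<close>. Treating disjoint pairs of rows one after the
  other, always averaging over the pairs of rows that are left, gains a constant factor in each
  of the order of \<open>\<lambda>\<^sup>2 n\<close> rounds. Markov's inequality concludes.
\<close>

section \<open>Anti-concentration of random subset sums\<close>

lemma sum_Pow_insert:
  assumes "finite N" "j \<notin> N"
  shows "(\<Sum>E\<in>Pow (insert j N). f E) = (\<Sum>E\<in>Pow N. f E + f (insert j E))"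
proof -
  have "inj_on (insert j) (Pow N)"
    using assms(2) by (auto simp: inj_on_def insert_ident)
  moreover have "Pow N \<inter> insert j ` Pow N = {}" using assms(2) by auto
  ultimately show ?thesis
    using assms by (simp add: Pow_insert sum.union_disjoint sum.reindex sum.distrib)
qed

text \<open>For uniformly random \<open>E\<close> this is a Rademacher sum with weights
  \<open>w\<close>.\<close>

definition signed_sum :: "('a \<Rightarrow> real) \<Rightarrow> 'a set \<Rightarrow> 'a set \<Rightarrow> real" where
  "signed_sum w N E = (\<Sum>j\<in>N. if j \<in> E then w j else - w j)"

lemma signed_sum_insert:
  assumes "finite N" "j \<notin> N" "E \<subseteq> N"
  shows "signed_sum w (insert j N) E = signed_sum w N E - w j"
    and "signed_sum w (insert j N) (insert j E) = signed_sum w N E + w j"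
proof -
  have "j \<notin> E" using assms by auto
  then show "signed_sum w (insert j N) E = signed_sum w N E - w j"
    using assms by (simp add: signed_sum_def)
  have "signed_sum w N (insert j E) = signed_sum w N E"
    unfolding signed_sum_def using assms(2) by (intro sum.cong) auto
  then show "signed_sum w (insert j N) (insert j E) = signed_sum w N E + w j"
    using assms by (simp add: signed_sum_def)
qed

text \<open>The shift \<open>a\<close> is arbitrary in the induction: the sign of a new index
  replaces \<open>a\<close> by \<open>a - w j\<close> or \<open>a + w j\<close>, and the cross terms
  cancel.\<close>

lemma signed_sum_second_moment:
  assumes "finite N"
  shows "(\<Sum>E\<in>Pow N. (a + signed_sum w N E)\<^sup>2) = 2 ^ card N * (a\<^sup>2 + (\<Sum>j\<in>N. (w j)\<^sup>2))"
  using assms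
proof (induction N arbitrary: a)
  case empty
  then show ?case by (simp add: signed_sum_def)
next
  case (insert j N)
  have "(\<Sum>E\<in>Pow (insert j N). (a + signed_sum w (insert j N) E)\<^sup>2)
      = (\<Sum>E\<in>Pow N. ((a - w j) + signed_sum w N E)\<^sup>2 + ((a + w j) + signed_sum w N E)\<^sup>2)"
    using insert.hyps unfolding sum_Pow_insert[OF insert.hyps]
    by (intro sum.cong) (simp_all add: signed_sum_insert algebra_simps)
  also have "\<dots> = 2 ^ card N * (((a - w j)\<^sup>2 + (\<Sum>j\<in>N. (w j)\<^sup>2))
      + ((a + w j)\<^sup>2 + (\<Sum>j\<in>N. (w j)\<^sup>2)))"
    by (simp only: sum.distrib insert.IH distrib_left)
  also have "\<dots> = 2 ^ card (insert j N) * (a\<^sup>2 + (\<Sum>j\<in>insert j N. (w j)\<^sup>2))"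
    using insert.hyps by (simp add: power2_eq_square algebra_simps)
  finally show ?case .
qed

text \<open>The bound is the Gaussian value, with the sum of squares as variance. Adding an index
  costs only a nonnegative multiple of \<open>(w j) ^ 4\<close>.\<close>

lemma signed_sum_fourth_moment:
  assumes "finite N"
  shows "(\<Sum>E\<in>Pow N. (a + signed_sum w N E) ^ 4)
    \<le> 2 ^ card N * (a ^ 4 + 6 * a\<^sup>2 * (\<Sum>j\<in>N. (w j)\<^sup>2) + 3 * (\<Sum>j\<in>N. (w j)\<^sup>2)\<^sup>2)"
  using assms
proof (induction N arbitrary: a)
  case empty
  then show ?case by (simp add: signed_sum_def)
next
  case (insert j N)
  define W where "W = (\<Sum>j\<in>N. (w j)\<^sup>2)"
  let ?B = "\<lambda>a. a ^ 4 + 6 * a\<^sup>2 * W + 3 * W\<^sup>2"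
  have "(\<Sum>E\<in>Pow (insert j N). (a + signed_sum w (insert j N) E) ^ 4)
      = (\<Sum>E\<in>Pow N. ((a - w j) + signed_sum w N E) ^ 4 + ((a + w j) + signed_sum w N E) ^ 4)"
    using insert.hyps unfolding sum_Pow_insert[OF insert.hyps]
    by (intro sum.cong) (simp_all add: signed_sum_insert algebra_simps)
  also have "\<dots> \<le> 2 ^ card N * ?B (a - w j) + 2 ^ card N * ?B (a + w j)"
    unfolding sum.distrib W_def by (intro add_mono insert.IH)
  also have "\<dots> = 2 ^ card N * (?B (a - w j) + ?B (a + w j))"
    by (simp only: distrib_left)
  also have "\<dots> \<le> 2 ^ card N * (2 * (a ^ 4 + 6 * a\<^sup>2 * ((w j)\<^sup>2 + W) + 3 * ((w j)\<^sup>2 + W)\<^sup>2))"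
  proof (intro mult_left_mono)
    have "2 * (a ^ 4 + 6 * a\<^sup>2 * ((w j)\<^sup>2 + W) + 3 * ((w j)\<^sup>2 + W)\<^sup>2)
        - (?B (a - w j) + ?B (a + w j)) = 4 * (w j) ^ 4"
      by (simp add: power2_eq_square power4_eq_xxxx algebra_simps)
    moreover have "0 \<le> 4 * (w j) ^ 4" by simp
    ultimately show "?B (a - w j) + ?B (a + w j)
        \<le> 2 * (a ^ 4 + 6 * a\<^sup>2 * ((w j)\<^sup>2 + W) + 3 * ((w j)\<^sup>2 + W)\<^sup>2)" by linarith
  qed simp
  also have "\<dots> = 2 ^ card (insert j N) * (a ^ 4 + 6 * a\<^sup>2 * (\<Sum>j\<in>insert j N. (w j)\<^sup>2)
      + 3 * (\<Sum>j\<in>insert j N. (w j)\<^sup>2)\<^sup>2)"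
    using insert.hyps by (simp add: W_def)
  finally show ?case .
qed

text \<open>
  A pointwise form of the Paley--Zygmund inequality: the quadratic in \<open>y\<^sup>2 / m\<close> is nonpositive
  below \<open>1 / 2\<close> and at most 8 everywhere.
\<close>

lemma one_minus_exp_ge_quadratic:
  fixes y m :: real
  assumes "m > 0"
  shows "(1 - exp (- m / 2)) / 8 * ((y\<^sup>2 / m - 1 / 2) * (6 - y\<^sup>2 / m)) \<le> 1 - exp (- y\<^sup>2)"
proof -
  define u where "u = y\<^sup>2 / m"
  have u: "u \<ge> 0" "y\<^sup>2 = m * u" using assms by (simp_all add: u_def)
  have c: "0 \<le> (1 - exp (- m / 2)) / 8" using assms by simp
  show ?thesis
  proof (cases "u \<le> 1 / 2")
    case True
    then have "(u - 1 / 2) * (6 - u) \<le> 0" by (intro mult_nonpos_nonneg) auto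
    then have "(1 - exp (- m / 2)) / 8 * ((u - 1 / 2) * (6 - u)) \<le> 0"
      by (rule mult_nonneg_nonpos[OF c])
    also have "0 \<le> 1 - exp (- y\<^sup>2)" by simp
    finally show ?thesis by (simp add: u_def)
  next
    case False
    have "8 - (u - 1 / 2) * (6 - u) = (u - 13 / 4)\<^sup>2 + 7 / 16"
      by (simp add: power2_eq_square algebra_simps)
    then have "(u - 1 / 2) * (6 - u) \<le> 8"
      using zero_le_power2[of "u - 13 / 4"] by linarith
    then have "(1 - exp (- m / 2)) / 8 * ((u - 1 / 2) * (6 - u)) \<le> (1 - exp (- m / 2)) / 8 * 8"
      by (rule mult_left_mono[OF _ c])
    also have "\<dots> \<le> 1 - exp (- y\<^sup>2)"
      using False assms by (simp add: u(2))
    finally show ?thesis by (simp add: u_def)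
  qed
qed

text \<open>Averaging the quadratic lower bound for \<open>1 - exp (- y\<^sup>2)\<close> needs only
  the second and fourth moments of a shifted Rademacher sum.\<close>

lemma sum_exp_subset_sum_le:
  fixes w :: "'a \<Rightarrow> real"
  assumes "finite N" and le: "(\<Sum>j\<in>N. (w j)\<^sup>2) \<le> 8"
  shows "(\<Sum>E\<in>Pow N. exp (- (a + (\<Sum>j\<in>E. w j))\<^sup>2))
    \<le> 2 ^ card N * (1 - (\<Sum>j\<in>N. (w j)\<^sup>2) / 256)"
proof -
  define Q where "Q = (\<Sum>j\<in>N. (w j)\<^sup>2)"
  \<comment> \<open>A subset sum is half the total plus half the signed sum. The first half is
    absorbed into the shift \<open>b\<close>, and \<open>m\<close> is the mean of
    \<open>(Y E)\<^sup>2\<close>.\<close>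
  define b where "b = a + (\<Sum>j\<in>N. w j) / 2"
  define v where "v j = w j / 2" for j
  define Y where "Y E = b + signed_sum v N E" for E
  define m where "m = b\<^sup>2 + Q / 4"
  have Q0: "Q \<ge> 0" by (simp add: Q_def sum_nonneg)
  have Qv: "(\<Sum>j\<in>N. (v j)\<^sup>2) = Q / 4"
    by (simp add: v_def Q_def power_divide sum_divide_distrib)
  have Y: "a + (\<Sum>j\<in>E. w j) = Y E" if "E \<subseteq> N" for E
  proof -
    have "(\<Sum>j\<in>E. w j) = (\<Sum>j\<in>N. if j \<in> E then w j else 0)"
      using that assms(1) by (simp add: sum.If_cases Int_absorb1 inf.absorb2)
    also have "\<dots> = (\<Sum>j\<in>N. w j / 2 + (if j \<in> E then v j else - v j))"
      by (intro sum.cong) (auto simp: v_def)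
    finally show ?thesis
      by (simp add: Y_def b_def signed_sum_def sum.distrib sum_divide_distrib)
  qed
  \<comment> \<open>The case \<open>Q = 0\<close> is split off because \<open>m\<close> may vanish
    there.\<close>
  have "2 ^ card N * (Q / 256) \<le> (\<Sum>E\<in>Pow N. 1 - exp (- (Y E)\<^sup>2))"
  proof (cases "Q = 0")
    case True
    then show ?thesis by (simp add: sum_nonneg)
  next
    case False
    with Q0 have m: "m > 0" by (simp add: m_def add_nonneg_pos)
    define k where "k = (1 - exp (- m / 2)) / 8"
    have k0: "k \<ge> 0" using m by (simp add: k_def)
    have m2: "(\<Sum>E\<in>Pow N. (Y E)\<^sup>2) = 2 ^ card N * m"
      unfolding Y_def m_def signed_sum_second_moment[OF assms(1)] Qv ..
    have "(\<Sum>E\<in>Pow N. (Y E) ^ 4) \<le> 2 ^ card N * (b ^ 4 + 6 * b\<^sup>2 * (Q / 4) + 3 * (Q / 4)\<^sup>2)"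
      unfolding Y_def using signed_sum_fourth_moment[OF assms(1), of b v] unfolding Qv .
    \<comment> \<open>The kurtosis bound 3 does not depend on the shift \<open>b\<close>.\<close>
    also have "\<dots> \<le> 2 ^ card N * (3 * m\<^sup>2)"
    proof (intro mult_left_mono)
      have "3 * m\<^sup>2 - (b ^ 4 + 6 * b\<^sup>2 * (Q / 4) + 3 * (Q / 4)\<^sup>2) = 2 * b ^ 4"
        unfolding m_def by (simp add: power2_eq_square power4_eq_xxxx algebra_simps)
      moreover have "0 \<le> 2 * b ^ 4" by simp
      ultimately show "b ^ 4 + 6 * b\<^sup>2 * (Q / 4) + 3 * (Q / 4)\<^sup>2 \<le> 3 * m\<^sup>2" by linarith
    qed simp
    finally have m4: "(\<Sum>E\<in>Pow N. (Y E) ^ 4) / m\<^sup>2 \<le> 2 ^ card N * 3"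
      using m by (simp add: divide_simps mult.assoc)
    have "1 - exp (- (Q / 8)) \<le> 1 - exp (- m / 2)" by (simp add: m_def)
    \<comment> \<open>The assumption that \<open>Q\<close> is at most 8 enters here: it makes
      \<open>1 - Q / 16\<close> dominate \<open>1 / (1 + Q / 8)\<close>.\<close>
    moreover have "Q / 16 \<le> 1 - exp (- (Q / 8))"
    proof -
      have "exp (- (Q / 8)) = 1 / exp (Q / 8)" by (simp add: exp_minus field_simps)
      also have "\<dots> \<le> 1 / (1 + Q / 8)"
        using Q0 exp_ge_add_one_self[of "Q / 8"] by (intro divide_left_mono) auto
      also have "\<dots> \<le> 1 - Q / 16"
      proof -
        have "0 \<le> Q * (8 - Q)" using Q0 le by (simp add: Q_def)
        then have "1 \<le> (1 - Q / 16) * (1 + Q / 8)" by (simp add: algebra_simps)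
        then show ?thesis using Q0 by (simp add: pos_divide_le_eq)
      qed
      finally show ?thesis by simp
    qed
    ultimately have "Q / 16 \<le> 1 - exp (- m / 2)" by (rule order_trans[rotated])
    then have kQ: "Q / 128 \<le> k" by (simp add: k_def)
    \<comment> \<open>The mean of the quadratic is at least \<open>13 / 2 - 3 - 3 = 1 / 2\<close>,
      which turns \<open>Q / 128\<close> into \<open>Q / 256\<close>.\<close>
    have "2 ^ card N * (Q / 256) \<le> k * (2 ^ card N / 2)"
      using mult_left_mono[OF kQ, of "2 ^ card N"] by simp
    also have "\<dots> \<le> k * (13 / 2 * 2 ^ card N - (\<Sum>E\<in>Pow N. (Y E) ^ 4) / m\<^sup>2 - 3 * 2 ^ card N)"
      using m4 by (intro mult_left_mono k0) linarith
    also have "\<dots> = k * (13 / 2 * ((\<Sum>E\<in>Pow N. (Y E)\<^sup>2) / m)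
        - (\<Sum>E\<in>Pow N. (Y E) ^ 4) / m\<^sup>2 - (\<Sum>E\<in>Pow N. 3))"
      using m assms(1) by (simp add: m2 card_Pow)
    also have "\<dots> = (\<Sum>E\<in>Pow N. k * (((Y E)\<^sup>2 / m - 1 / 2) * (6 - (Y E)\<^sup>2 / m)))"
    proof -
      have "((Y E)\<^sup>2 / m - 1 / 2) * (6 - (Y E)\<^sup>2 / m)
          = 13 / 2 * ((Y E)\<^sup>2 / m) - (Y E) ^ 4 / m\<^sup>2 - 3" for E
        by (simp add: algebra_simps power2_eq_square power4_eq_xxxx)
      then show ?thesis
        by (simp only: sum_distrib_left[symmetric] sum_subtractf sum_divide_distrib[symmetric])
    qed
    also have "\<dots> \<le> (\<Sum>E\<in>Pow N. 1 - exp (- (Y E)\<^sup>2))"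
      unfolding k_def by (intro sum_mono one_minus_exp_ge_quadratic m)
    finally show ?thesis .
  qed
  then have "(\<Sum>E\<in>Pow N. exp (- (Y E)\<^sup>2)) \<le> 2 ^ card N * (1 - Q / 256)"
    using assms(1) by (simp add: sum_subtractf card_Pow algebra_simps)
  moreover have "(\<Sum>E\<in>Pow N. exp (- (a + (\<Sum>j\<in>E. w j))\<^sup>2)) = (\<Sum>E\<in>Pow N. exp (- (Y E)\<^sup>2))"
    by (intro sum.cong) (auto simp: Y)
  ultimately show ?thesis by (simp add: Q_def)
qed

section \<open>Switchings\<close>

text \<open>For entries in \<open>{0, 1}\<close> the block in rows \<open>i\<close>,
  \<open>i'\<close> and columns \<open>j\<close>, \<open>k\<close> is then a permutation matrix;
  flipping its four entries gives the other one.\<close>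

definition switchable :: "real mat \<Rightarrow> nat \<Rightarrow> nat \<Rightarrow> nat \<Rightarrow> nat \<Rightarrow> bool" where
  "switchable A i i' j k \<longleftrightarrow>
     A $$ (i, j) \<noteq> A $$ (i, k) \<and> A $$ (i', j) \<noteq> A $$ (i, j) \<and> A $$ (i', k) \<noteq> A $$ (i, k)"

text \<open>
  Columns are matched by the involution \<open>p\<close>; the pair \<open>{j, p j}\<close> is selected by \<open>E\<close> through its
  smaller element.
\<close>

definition switch :: "nat \<Rightarrow> (nat \<Rightarrow> nat) \<Rightarrow> nat \<Rightarrow> nat \<Rightarrow> nat set \<Rightarrow> real mat \<Rightarrow> real mat" where
  "switch n p i i' E A = mat n n (\<lambda>(r, j).
     if r \<in> {i, i'} \<and> min j (p j) \<in> E \<and> switchable A i i' j (p j) then 1 - A $$ (r, j)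
     else A $$ (r, j))"

text \<open>Fixed points are allowed, as a column paired with itself is never switchable.\<close>

definition involution_below :: "nat \<Rightarrow> (nat \<Rightarrow> nat) \<Rightarrow> bool" where
  "involution_below n p \<longleftrightarrow> (\<forall>j<n. p j < n \<and> p (p j) = j)"

lemma involution_below_reindex:
  assumes "involution_below n p"
  shows "(\<Sum>j<n. f (p j)) = (\<Sum>j<n. f j)"
  using assms by (intro sum.reindex_bij_witness[of _ p p]) (auto simp: involution_below_def)

text \<open>Each two-element orbit is charged to its smaller element.\<close>

lemma involution_below_sum:
  fixes f :: "nat \<Rightarrow> real"
  assumes p: "involution_below n p" and fixed: "\<And>j. j < n \<Longrightarrow> p j = j \<Longrightarrow> f j = 0"
  shows "(\<Sum>j<n. f j) = (\<Sum>j<n. if j < p j then f j + f (p j) else 0)"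
proof -
  have "(\<Sum>j<n. f j) = (\<Sum>j<n. (if j < p j then f j else 0) + (if p j < j then f j else 0))"
    using fixed by (intro sum.cong refl) (auto simp: not_less intro: antisym)
  also have "\<dots> = (\<Sum>j<n. if j < p j then f j else 0) + (\<Sum>j<n. if p j < j then f j else 0)"
    by (rule sum.distrib)
  also have "(\<Sum>j<n. if p j < j then f j else 0) = (\<Sum>j<n. if j < p j then f (p j) else 0)"
    by (subst involution_below_reindex[OF p, symmetric], intro sum.cong)
      (use p in \<open>auto simp: involution_below_def\<close>)
  finally show ?thesis
    by (simp add: sum.distrib[symmetric] if_distrib cong: if_cong)
qed


lemma regular_mats_entry:
  assumes "A \<in> regular_mats n d" "i < n" "j < n"
  shows "A $$ (i, j) = 0 \<or> A $$ (i, j) = 1"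
  using assms by (auto simp: regular_mats_def)

lemma switchable_commute: "switchable A i i' k j \<longleftrightarrow> switchable A i i' j k"
  by (auto simp: switchable_def)

lemma switchable_irrefl: "\<not> switchable A i i' j j"
  by (simp add: switchable_def)

lemma switch_index:
  assumes "r < n" "j < n"
  shows "switch n p i i' E A $$ (r, j) =
    (if r \<in> {i, i'} \<and> min j (p j) \<in> E \<and> switchable A i i' j (p j) then 1 - A $$ (r, j)
     else A $$ (r, j))"
  using assms by (simp add: switch_def)

text \<open>The value \<open>min j (p j)\<close> is the same at \<open>j\<close> and at
  \<open>p j\<close>, so a block is flipped as a whole or left alone, and complementing all four
  entries preserves the inequalities.\<close>

lemma switchable_switch:
  assumes "involution_below n p" "i < n" "i' < n" "j < n"
  shows "switchable (switch n p i i' E A) i i' j (p j) \<longleftrightarrow> switchable A i i' j (p j)"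
proof -
  have pj: "p j < n" "p (p j) = j" using assms by (auto simp: involution_below_def)
  have "min (p j) (p (p j)) = min j (p j)" "switchable A i i' (p j) (p (p j)) = switchable A i i' j (p j)"
    by (simp_all add: pj switchable_commute min.commute)
  then show ?thesis
    using assms pj(1)
    by (cases "min j (p j) \<in> E \<and> switchable A i i' j (p j)")
       (auto simp: switchable_def[of "switch n p i i' E A"] switchable_def[of A] switch_index)
qed

lemma switch_switch:
  assumes "A \<in> carrier_mat n n" "involution_below n p" "i < n" "i' < n"
  shows "switch n p i i' E (switch n p i i' E A) = A"
proof (rule eq_matI)
  fix r j assume "r < dim_row A" "j < dim_col A"
  then have rj: "r < n" "j < n" using assms(1) by auto
  show "switch n p i i' E (switch n p i i' E A) $$ (r, j) = A $$ (r, j)"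
    unfolding switch_index[OF rj] switchable_switch[OF assms(2-4) rj(2)] by auto
qed (use assms(1) in \<open>auto simp: switch_def\<close>)

text \<open>In a switchable pair the two entries of either row are complementary, so flipping them
  changes the sum by plus or minus \<open>y j - y (p j)\<close>. Constant \<open>y\<close> will give
  the row sums, \<open>y = x\<close> the coordinates of \<open>A x\<close>.\<close>

lemma sum_switch_row:
  assumes A: "A \<in> regular_mats n d" and p: "involution_below n p"
    and i: "i < n" "i' < n" and r: "r \<in> {i, i'}"
  shows "(\<Sum>j<n. switch n p i i' E A $$ (r, j) * y j) = (\<Sum>j<n. A $$ (r, j) * y j)
    + (\<Sum>j<n. if j \<in> E \<and> j < p j \<and> switchable A i i' j (p j)
        then (1 - 2 * A $$ (r, j)) * (y j - y (p j)) else 0)"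
proof -
  define h where "h j = (if min j (p j) \<in> E \<and> switchable A i i' j (p j)
    then (1 - 2 * A $$ (r, j)) * y j else 0)" for j
  have rn: "r < n" using i r by auto
  have "(\<Sum>j<n. switch n p i i' E A $$ (r, j) * y j) = (\<Sum>j<n. A $$ (r, j) * y j + h j)"
    using r rn by (intro sum.cong) (auto simp: switch_index h_def algebra_simps)
  also have "\<dots> = (\<Sum>j<n. A $$ (r, j) * y j) + (\<Sum>j<n. h j)"
    by (rule sum.distrib)
  also have "(\<Sum>j<n. h j) = (\<Sum>j<n. if j < p j then h j + h (p j) else 0)"
    using p by (rule involution_below_sum) (simp add: h_def switchable_irrefl)
  also have "\<dots> = (\<Sum>j<n. if j \<in> E \<and> j < p j \<and> switchable A i i' j (p j)
        then (1 - 2 * A $$ (r, j)) * (y j - y (p j)) else 0)"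
  proof (intro sum.cong refl)
    fix j assume "j \<in> {..<n}"
    then have j: "j < n" "p j < n" "p (p j) = j" using p by (auto simp: involution_below_def)
    have flip: "A $$ (r, p j) = 1 - A $$ (r, j)" if "switchable A i i' j (p j)"
      using that r regular_mats_entry[OF A i(1) j(1)] regular_mats_entry[OF A i(2) j(1)]
        regular_mats_entry[OF A i(1) j(2)] regular_mats_entry[OF A i(2) j(2)]
      by (auto simp: switchable_def)
    have "(1 - 2 * A $$ (r, j)) * y j + (1 - 2 * A $$ (r, p j)) * y (p j)
        = (1 - 2 * A $$ (r, j)) * (y j - y (p j))" if "switchable A i i' j (p j)"
      unfolding flip[OF that] by (simp add: algebra_simps)
    then show "(if j < p j then h j + h (p j) else 0) =
        (if j \<in> E \<and> j < p j \<and> switchable A i i' j (p j)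
          then (1 - 2 * A $$ (r, j)) * (y j - y (p j)) else 0)"
      using j by (auto simp: h_def min_def switchable_commute)
  qed
  finally show ?thesis .
qed

text \<open>For the row sums, \<open>sum_switch_row\<close> is used with constant \<open>y\<close>;
  in a column, a flip exchanges a 0 and a 1.\<close>

lemma switch_in_regular_mats:
  assumes A: "A \<in> regular_mats n d" and p: "involution_below n p"
    and i: "i < n" "i' < n" "i \<noteq> i'"
  shows "switch n p i i' E A \<in> regular_mats n d"
proof -
  let ?B = "switch n p i i' E A"
  have entry: "?B $$ (r, j) \<in> {0, 1}" if "r < n" "j < n" for r j
    using regular_mats_entry[OF A that] that by (auto simp: switch_index)
  have row: "(\<Sum>j<n. ?B $$ (r, j)) = real d" if "r < n" for r
  proof (cases "r \<in> {i, i'}")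
    case True
    then show ?thesis
      using sum_switch_row[OF A p i(1,2) True, of E "\<lambda>_. 1"] A that
      by (auto simp: regular_mats_def cong: if_cong)
  next
    case False
    then have "(\<Sum>j<n. ?B $$ (r, j)) = (\<Sum>j<n. A $$ (r, j))"
      using that by (intro sum.cong) (auto simp: switch_index)
    then show ?thesis using A that by (auto simp: regular_mats_def)
  qed
  have col: "(\<Sum>r<n. ?B $$ (r, j)) = real d" if "j < n" for j
  proof -
    have "(\<Sum>r<n. ?B $$ (r, j) - A $$ (r, j)) = (\<Sum>r\<in>{i, i'}. ?B $$ (r, j) - A $$ (r, j))"
      using i that by (intro sum.mono_neutral_right) (auto simp: switch_index)
    also have "\<dots> = 0"
      using i that regular_mats_entry[OF A i(1) that] regular_mats_entry[OF A i(2) that]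
      by (auto simp: switch_index switchable_def)
    finally show ?thesis using A that by (auto simp: sum_subtractf regular_mats_def)
  qed
  have "?B \<in> carrier_mat n n" by (simp add: switch_def)
  with entry row col show ?thesis unfolding regular_mats_def by blast
qed

text \<open>A switching is an involution of \<open>regular_mats n d\<close>, hence preserves the
  uniform distribution. This allows random flips to be inserted into any average.\<close>

lemma sum_switch_reindex:
  assumes "involution_below n p" "i < n" "i' < n" "i \<noteq> i'"
  shows "(\<Sum>A\<in>regular_mats n d. F (switch n p i i' E A)) = (\<Sum>A\<in>regular_mats n d. F A)"
proof (rule sum.reindex_bij_witness[of _ "switch n p i i' E" "switch n p i i' E"])
  fix A assume A: "A \<in> regular_mats n d"
  then have "A \<in> carrier_mat n n" by (simp add: regular_mats_def)
  with assms show "switch n p i i' E (switch n p i i' E A) = A"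
    by (intro switch_switch)
  from this show "switch n p i i' E (switch n p i i' E A) = A" .
  from A assms show "switch n p i i' E A \<in> regular_mats n d"
    by (intro switch_in_regular_mats)
  from this show "switch n p i i' E A \<in> regular_mats n d" .
qed simp

section \<open>Averaging over random switchings\<close>

definition row_form :: "nat \<Rightarrow> (nat \<Rightarrow> real) \<Rightarrow> real mat \<Rightarrow> nat \<Rightarrow> real" where
  "row_form n x A i = (\<Sum>j<n. A $$ (i, j) * x j)"

text \<open>For one fixed matching the selected pairs enter row \<open>i\<close> additively, so the
  subset-sum bound applies. The constant is \<open>512 = 2 * 256\<close> because the sum over
  \<open>j\<close> meets each pair twice.\<close>

lemma sum_exp_switch_le:
  assumes A: "A \<in> regular_mats n d" and p: "involution_below n p"
    and i: "i < n" "i' < n" and x: "(\<Sum>j<n. (x j)\<^sup>2) \<le> 1"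
  shows "(\<Sum>E\<in>Pow {..<n}. exp (- (row_form n x (switch n p i i' E A) i)\<^sup>2))
    \<le> 2 ^ n * (1 - (\<Sum>j<n. if switchable A i i' j (p j) then (x j - x (p j))\<^sup>2 else 0) / 512)"
proof -
  \<comment> \<open>The weights live on the smaller elements of switchable pairs. Other indices in
    \<open>E\<close> change nothing, so summing over all subsets repeats each pattern of flips
    equally often.\<close>
  define w where "w j = (if j < p j \<and> switchable A i i' j (p j)
    then (1 - 2 * A $$ (i, j)) * (x j - x (p j)) else 0)" for j
  define T where "T = (\<Sum>j<n. if switchable A i i' j (p j) then (x j - x (p j))\<^sup>2 else 0)"
  have w2: "(w j)\<^sup>2 = (if j < p j \<and> switchable A i i' j (p j) then (x j - x (p j))\<^sup>2 else 0)"
    if "j < n" for j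
    using regular_mats_entry[OF A i(1) that] by (auto simp: w_def power2_commute)
  have "T = (\<Sum>j<n. 2 * (w j)\<^sup>2)"
    unfolding T_def using p
    by (subst involution_below_sum[OF p])
       (auto simp: switchable_irrefl switchable_commute w2 involution_below_def power2_commute
         intro!: sum.cong)
  then have T: "(\<Sum>j<n. (w j)\<^sup>2) = T / 2" by (simp add: sum_distrib_left[symmetric])
  have "T \<le> (\<Sum>j<n. 2 * (x j)\<^sup>2 + 2 * (x (p j))\<^sup>2)"
  proof (unfold T_def, intro sum_mono)
    fix j
    have "(x j - x (p j))\<^sup>2 + (x j + x (p j))\<^sup>2 = 2 * (x j)\<^sup>2 + 2 * (x (p j))\<^sup>2"
      by (simp add: power2_eq_square algebra_simps)
    then have "(x j - x (p j))\<^sup>2 \<le> 2 * (x j)\<^sup>2 + 2 * (x (p j))\<^sup>2"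
      using zero_le_power2[of "x j + x (p j)"] by linarith
    then show "(if switchable A i i' j (p j) then (x j - x (p j))\<^sup>2 else 0)
        \<le> 2 * (x j)\<^sup>2 + 2 * (x (p j))\<^sup>2"
      by simp
  qed
  also have "\<dots> = 4 * (\<Sum>j<n. (x j)\<^sup>2)"
    using involution_below_reindex[OF p, of "\<lambda>j. (x j)\<^sup>2"]
    by (simp add: sum.distrib sum_distrib_left[symmetric])
  finally have "(\<Sum>j<n. (w j)\<^sup>2) \<le> 8" using x T by linarith
  then have "(\<Sum>E\<in>Pow {..<n}. exp (- (row_form n x A i + (\<Sum>j\<in>E. w j))\<^sup>2))
    \<le> 2 ^ n * (1 - T / 512)"
    using sum_exp_subset_sum_le[of "{..<n}" w "row_form n x A i"] by (simp add: T)
  moreover have "row_form n x (switch n p i i' E A) i = row_form n x A i + (\<Sum>j\<in>E. w j)"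
    if "E \<subseteq> {..<n}" for E
  proof -
    have "(\<Sum>j\<in>E. w j) = (\<Sum>j<n. if j \<in> E then w j else 0)"
      using that by (simp add: sum.If_cases inf.absorb2)
    also have "\<dots> = (\<Sum>j<n. if j \<in> E \<and> j < p j \<and> switchable A i i' j (p j)
        then (1 - 2 * A $$ (i, j)) * (x j - x (p j)) else 0)"
      by (intro sum.cong) (auto simp: w_def)
    finally show ?thesis
      using sum_switch_row[OF A p i, of i E x] by (simp add: row_form_def)
  qed
  ultimately show ?thesis by (simp add: T_def)
qed

text \<open>This is \<open>s - j\<close> modulo \<open>n\<close> for \<open>j < n\<close>; writing
  \<open>n - j\<close> keeps the subtraction of natural numbers from truncating.\<close>

definition reflect :: "nat \<Rightarrow> nat \<Rightarrow> nat \<Rightarrow> nat" where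
  "reflect n s j = (s + (n - j)) mod n"

lemma reflect_add_mod: "j < n \<Longrightarrow> s < n \<Longrightarrow> (reflect n s j + j) mod n = s"
  unfolding reflect_def mod_add_left_eq by simp

lemma reflect_unique: "j < n \<Longrightarrow> k < n \<Longrightarrow> reflect n ((k + j) mod n) j = k"
  unfolding reflect_def mod_add_left_eq by simp

lemma involution_below_reflect:
  assumes "s < n" shows "involution_below n (reflect n s)"
  unfolding involution_below_def
proof (intro allI impI conjI)
  fix j assume j: "j < n"
  then show lt: "reflect n s j < n" by (simp add: reflect_def)
  show "reflect n s (reflect n s j) = j"
    using reflect_unique[OF lt j] reflect_add_mod[OF j assms] by (simp add: add.commute)
qed

lemma sum_reflect:
  assumes "j < n" shows "(\<Sum>s<n. f (reflect n s j)) = (\<Sum>k<n. f k)"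
  using assms
  by (intro sum.reindex_bij_witness[of _ "\<lambda>k. (k + j) mod n" "\<lambda>s. reflect n s j"])
     (auto simp: reflect_add_mod reflect_unique, auto simp: reflect_def)

text \<open>Dividing by \<open>2 * n\<close> makes this the average, over all reflections, of the
  sum over unordered matched pairs that are switchable; it is at most 1 for a unit vector.\<close>

definition switch_energy :: "nat \<Rightarrow> (nat \<Rightarrow> real) \<Rightarrow> real mat \<Rightarrow> nat \<Rightarrow> nat \<Rightarrow> real" where
  "switch_energy n x A i i' =
     (\<Sum>j<n. \<Sum>k<n. if switchable A i i' j k then (x j - x k)\<^sup>2 else 0) / (2 * real n)"

text \<open>
  As \<open>s\<close> varies, the reflections \<open>j \<mapsto> s - j\<close> modulo \<open>n\<close> match every ordered pair of
  columns exactly once, so averaging over them produces the sum over all pairs of columns.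
\<close>

lemma sum_exp_row_form_le:
  assumes i: "i < n" "i' < n" "i \<noteq> i'" and x: "(\<Sum>j<n. (x j)\<^sup>2) \<le> 1"
    and G0: "\<And>A. A \<in> regular_mats n d \<Longrightarrow> 0 \<le> G A"
    and G: "\<And>p E A. involution_below n p \<Longrightarrow> A \<in> regular_mats n d \<Longrightarrow> G (switch n p i i' E A) = G A"
  shows "(\<Sum>A\<in>regular_mats n d. exp (- (row_form n x A i)\<^sup>2) * G A)
    \<le> (\<Sum>A\<in>regular_mats n d. (1 - switch_energy n x A i i' / 256) * G A)"
proof -
  let ?M = "regular_mats n d"
  let ?T = "\<lambda>A s. \<Sum>j<n. if switchable A i i' j (reflect n s j) then (x j - x (reflect n s j))\<^sup>2 else 0"
  let ?L = "\<Sum>A\<in>?M. exp (- (row_form n x A i)\<^sup>2) * G A"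
  have n: "n > 0" using i by simp
  have T: "(\<Sum>s<n. ?T A s) = 2 * n * switch_energy n x A i i'" for A
  proof -
    have "(\<Sum>s<n. ?T A s) = (\<Sum>j<n. \<Sum>s<n. if switchable A i i' j (reflect n s j)
        then (x j - x (reflect n s j))\<^sup>2 else 0)"
      by (rule sum.swap)
    also have "\<dots> = (\<Sum>j<n. \<Sum>k<n. if switchable A i i' j k then (x j - x k)\<^sup>2 else 0)"
    proof (rule sum.cong[OF refl])
      fix j assume "j \<in> {..<n}"
      then show "(\<Sum>s<n. if switchable A i i' j (reflect n s j) then (x j - x (reflect n s j))\<^sup>2 else 0)
          = (\<Sum>k<n. if switchable A i i' j k then (x j - x k)\<^sup>2 else 0)"
        using sum_reflect[of j n "\<lambda>k. if switchable A i i' j k then (x j - x k)\<^sup>2 else 0"] by simp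
    qed
    finally show ?thesis using n by (simp add: switch_energy_def)
  qed
  \<comment> \<open>The sum is copied once per reflection and per set \<open>E\<close>, and each
    copy is reindexed by its own switching, which leaves \<open>G\<close> unchanged.\<close>
  have "n * 2 ^ n * ?L = (\<Sum>s<n. \<Sum>E\<in>Pow {..<n}. ?L)"
    by (simp add: card_Pow)
  also have "\<dots> = (\<Sum>s<n. \<Sum>E\<in>Pow {..<n}. \<Sum>A\<in>?M.
      exp (- (row_form n x (switch n (reflect n s) i i' E A) i)\<^sup>2) * G A)"
  proof (rule sum.cong[OF refl], rule sum.cong[OF refl])
    fix s E assume "s \<in> {..<n}"
    then have p: "involution_below n (reflect n s)" by (simp add: involution_below_reflect)
    show "?L = (\<Sum>A\<in>?M. exp (- (row_form n x (switch n (reflect n s) i i' E A) i)\<^sup>2) * G A)"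
      by (subst sum_switch_reindex[OF p i, symmetric]) (simp add: G[OF p])
  qed
  also have "\<dots> = (\<Sum>s<n. \<Sum>A\<in>?M.
      (\<Sum>E\<in>Pow {..<n}. exp (- (row_form n x (switch n (reflect n s) i i' E A) i)\<^sup>2)) * G A)"
    by (subst sum.swap) (simp add: sum_distrib_right)
  also have "\<dots> \<le> (\<Sum>s<n. \<Sum>A\<in>?M. 2 ^ n * (1 - ?T A s / 512) * G A)"
    using i x G0
    by (intro sum_mono mult_right_mono sum_exp_switch_le) (auto simp: involution_below_reflect)
  also have "\<dots> = (\<Sum>A\<in>?M. (\<Sum>s<n. 2 ^ n * (1 - ?T A s / 512)) * G A)"
    by (subst sum.swap) (simp add: sum_distrib_right)
  also have "\<dots> = (\<Sum>A\<in>?M. n * 2 ^ n * ((1 - switch_energy n x A i i' / 256) * G A))"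
  proof (intro sum.cong refl)
    fix A
    have "(\<Sum>s<n. 2 ^ n * (1 - ?T A s / 512)) = 2 ^ n * (n - (\<Sum>s<n. ?T A s) / 512)"
      by (simp only: sum_distrib_left[symmetric] sum_subtractf sum_divide_distrib[symmetric]) simp
    also have "\<dots> = n * 2 ^ n * (1 - switch_energy n x A i i' / 256)"
      unfolding T by (simp add: algebra_simps)
    finally show "(\<Sum>s<n. 2 ^ n * (1 - ?T A s / 512)) * G A
        = n * 2 ^ n * ((1 - switch_energy n x A i i' / 256) * G A)" by (simp add: mult.assoc)
  qed
  also have "\<dots> = n * 2 ^ n * (\<Sum>A\<in>?M. (1 - switch_energy n x A i i' / 256) * G A)"
    by (simp add: sum_distrib_left)
  finally show ?thesis using n by (simp add: mult_le_cancel_left_pos)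
qed


section \<open>The average switching energy\<close>

lemma sum_square_diff:
  fixes x :: "nat \<Rightarrow> real"
  shows "(\<Sum>j<n. \<Sum>k<n. (x j - x k)\<^sup>2) = 2 * n * (\<Sum>j<n. (x j)\<^sup>2) - 2 * (\<Sum>j<n. x j)\<^sup>2"
proof -
  have "(x j - x k)\<^sup>2 = (x j)\<^sup>2 + (x k)\<^sup>2 - 2 * (x j * x k)" for j k
    by (simp add: power2_eq_square algebra_simps)
  then have "(\<Sum>j<n. \<Sum>k<n. (x j - x k)\<^sup>2)
      = n * (\<Sum>j<n. (x j)\<^sup>2) + n * (\<Sum>j<n. (x j)\<^sup>2) - 2 * (\<Sum>j<n. \<Sum>k<n. x j * x k)"
    by (simp add: sum.distrib sum_subtractf sum_distrib_left)
  moreover have "(\<Sum>j<n. \<Sum>k<n. x j * x k) = (\<Sum>j<n. x j)\<^sup>2"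
    by (simp add: power2_eq_square sum_product)
  ultimately show ?thesis by simp
qed

lemma switch_energy_nonneg: "0 \<le> switch_energy n x A i i'"
  by (simp add: switch_energy_def sum_nonneg)

lemma switch_energy_le_1:
  assumes "(\<Sum>j<n. (x j)\<^sup>2) \<le> 1"
  shows "switch_energy n x A i i' \<le> 1"
proof (cases "n = 0")
  case False
  have "(\<Sum>j<n. \<Sum>k<n. if switchable A i i' j k then (x j - x k)\<^sup>2 else 0)
      \<le> (\<Sum>j<n. \<Sum>k<n. (x j - x k)\<^sup>2)"
    by (intro sum_mono) auto
  also have "\<dots> \<le> 2 * n * (\<Sum>j<n. (x j)\<^sup>2)"
    unfolding sum_square_diff by simp
  also have "\<dots> \<le> 2 * n"
    using assms by (simp add: mult_left_le)
  finally show ?thesis using False by (simp add: switch_energy_def)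
qed (simp add: switch_energy_def)

text \<open>Half the Hamming distance of two columns, as all columns have the same sum.\<close>

definition col_dist :: "nat \<Rightarrow> real mat \<Rightarrow> nat \<Rightarrow> nat \<Rightarrow> real" where
  "col_dist n A j k = (\<Sum>i<n. A $$ (i, j) * (1 - A $$ (i, k)))"

lemma col_dist_commute:
  assumes "A \<in> regular_mats n d" "j < n" "k < n"
  shows "col_dist n A j k = col_dist n A k j"
  using assms
  by (simp add: col_dist_def regular_mats_def algebra_simps sum_subtractf)

lemma col_dist_nonneg:
  assumes "A \<in> regular_mats n d" "j < n" "k < n"
  shows "0 \<le> col_dist n A j k"
  unfolding col_dist_def
proof (intro sum_nonneg)
  fix i assume "i \<in> {..<n}"
  then show "0 \<le> A $$ (i, j) * (1 - A $$ (i, k))"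
    using regular_mats_entry[OF assms(1), of i j] regular_mats_entry[OF assms(1), of i k] assms
    by auto
qed

text \<open>In a row with 1 in column \<open>j\<close> and 0 in column \<open>l\<close>, either
  value in column \<open>k\<close> makes one term on the right equal to 1.\<close>

lemma col_dist_triangle:
  assumes "A \<in> regular_mats n d" "j < n" "k < n" "l < n"
  shows "col_dist n A j l \<le> col_dist n A j k + col_dist n A k l"
  unfolding col_dist_def sum.distrib[symmetric]
proof (intro sum_mono)
  fix i assume "i \<in> {..<n}"
  then show "A $$ (i, j) * (1 - A $$ (i, l))
      \<le> A $$ (i, j) * (1 - A $$ (i, k)) + A $$ (i, k) * (1 - A $$ (i, l))"
    using regular_mats_entry[OF assms(1), of i j] regular_mats_entry[OF assms(1), of i k]
      regular_mats_entry[OF assms(1), of i l] assms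
    by auto
qed

text \<open>Double counting: each of the \<open>d\<close> ones of column \<open>j\<close> lies in a
  row with \<open>n - d\<close> zeros.\<close>

lemma sum_col_dist:
  assumes "A \<in> regular_mats n d" "j < n"
  shows "(\<Sum>l<n. col_dist n A j l) = real d * (real n - real d)"
proof -
  have "(\<Sum>l<n. col_dist n A j l) = (\<Sum>i<n. \<Sum>l<n. A $$ (i, j) * (1 - A $$ (i, l)))"
    unfolding col_dist_def by (rule sum.swap)
  also have "\<dots> = (\<Sum>i<n. A $$ (i, j) * (real n - real d))"
    using assms(1) by (intro sum.cong refl)
      (simp add: sum_distrib_left[symmetric] sum_subtractf regular_mats_def)
  also have "\<dots> = real d * (real n - real d)"
    using assms by (simp add: sum_distrib_right[symmetric] regular_mats_def)
  finally show ?thesis .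
qed

text \<open>Cauchy--Schwarz applied to \<open>sum_col_dist\<close>, with \<open>n - d\<close> at
  least \<open>n / 2\<close>.\<close>

lemma sum_col_dist_square_ge:
  assumes "A \<in> regular_mats n d" "j < n" "2 * d \<le> n"
  shows "real n * (real d)\<^sup>2 / 4 \<le> (\<Sum>l<n. (col_dist n A j l)\<^sup>2)"
proof -
  have n: "real n > 0" using assms by simp
  have "real d * (real n / 2) \<le> real d * (real n - real d)"
    using assms(3) by (intro mult_left_mono) auto
  then have "(real d * (real n / 2))\<^sup>2 \<le> (real d * (real n - real d))\<^sup>2"
    by (intro power_mono) auto
  also have "\<dots> \<le> (\<Sum>l<n. (col_dist n A j l)\<^sup>2) * n"
    using sum_squared_le_sum_of_squares[of "col_dist n A j" "{..<n}"]
    by (simp add: sum_col_dist[OF assms(1,2)] mult.commute)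
  finally have "real n * (real n * (real d)\<^sup>2 / 4) \<le> real n * (\<Sum>l<n. (col_dist n A j l)\<^sup>2)"
    by (simp add: power2_eq_square algebra_simps)
  then show ?thesis using n by simp
qed

text \<open>One of \<open>q\<close> and \<open>r\<close> is at least \<open>p / 2\<close>. If it is
  \<open>q\<close>, the first term on the right suffices; if it is \<open>r\<close>, then
  \<open>x\<close> and \<open>y\<close> are compared through \<open>z\<close>. In the application
  \<open>p\<close>, \<open>q\<close>, \<open>r\<close> are the distances among three columns and
  \<open>x\<close>, \<open>y\<close>, \<open>z\<close> the values of the vector there.\<close>

lemma three_point_bound:
  fixes x y z p q r :: real
  assumes "0 \<le> p" "0 \<le> q" "0 \<le> r" "p \<le> q + r"
  shows "(x - y)\<^sup>2 * p\<^sup>2 \<le> 8 * (q\<^sup>2 * (x - y)\<^sup>2 + p\<^sup>2 * (x - z)\<^sup>2 + r\<^sup>2 * (y - z)\<^sup>2)"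
proof -
  have nonneg: "0 \<le> q\<^sup>2 * (x - y)\<^sup>2" "0 \<le> p\<^sup>2 * (x - z)\<^sup>2" "0 \<le> r\<^sup>2 * (y - z)\<^sup>2" by simp_all
  consider "p \<le> 2 * q" | "p \<le> 2 * r" using assms(4) by linarith
  then show ?thesis
  proof cases
    case 1
    then have "p\<^sup>2 \<le> (2 * q)\<^sup>2" using assms by (intro power_mono) auto
    then have "(x - y)\<^sup>2 * p\<^sup>2 \<le> (x - y)\<^sup>2 * (4 * q\<^sup>2)"
      by (intro mult_left_mono) (simp_all add: power_mult_distrib)
    also have "\<dots> = 4 * (q\<^sup>2 * (x - y)\<^sup>2)" by simp
    finally have "(x - y)\<^sup>2 * p\<^sup>2 \<le> 4 * (q\<^sup>2 * (x - y)\<^sup>2)" .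
    moreover have "a \<le> 4 * b \<Longrightarrow> 0 \<le> b \<Longrightarrow> 0 \<le> c \<Longrightarrow> 0 \<le> e \<Longrightarrow> a \<le> 8 * (b + c + e)" for a b c e :: real
      by simp
    ultimately show ?thesis using nonneg by blast
  next
    case 2
    then have "p\<^sup>2 \<le> (2 * r)\<^sup>2" using assms by (intro power_mono) auto
    then have "p\<^sup>2 * (y - z)\<^sup>2 \<le> 4 * r\<^sup>2 * (y - z)\<^sup>2"
      by (intro mult_right_mono) (simp_all add: power_mult_distrib)
    then have pr: "p\<^sup>2 * (y - z)\<^sup>2 \<le> 4 * (r\<^sup>2 * (y - z)\<^sup>2)" by (simp only: mult.assoc)
    have "(x - y)\<^sup>2 + (x + y - 2 * z)\<^sup>2 = 2 * (x - z)\<^sup>2 + 2 * (y - z)\<^sup>2"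
      by (simp add: power2_eq_square algebra_simps)
    then have "(x - y)\<^sup>2 \<le> 2 * (x - z)\<^sup>2 + 2 * (y - z)\<^sup>2"
      using zero_le_power2[of "x + y - 2 * z"] by linarith
    then have "(x - y)\<^sup>2 * p\<^sup>2 \<le> (2 * (x - z)\<^sup>2 + 2 * (y - z)\<^sup>2) * p\<^sup>2"
      by (intro mult_right_mono) auto
    also have "\<dots> = 2 * (p\<^sup>2 * (x - z)\<^sup>2) + 2 * (p\<^sup>2 * (y - z)\<^sup>2)"
      by (simp add: algebra_simps)
    finally have "(x - y)\<^sup>2 * p\<^sup>2 \<le> 2 * (p\<^sup>2 * (x - z)\<^sup>2) + 2 * (p\<^sup>2 * (y - z)\<^sup>2)" .
    moreover have "a \<le> 2 * c + 2 * f \<Longrightarrow> f \<le> 4 * e \<Longrightarrow> 0 \<le> b \<Longrightarrow> 0 \<le> c \<Longrightarrow> 0 \<le> e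
        \<Longrightarrow> a \<le> 8 * (b + c + e)" for a b c e f :: real
      by simp
    ultimately show ?thesis using nonneg pr by blast
  qed
qed

text \<open>
  Columns at small distance contribute little to this sum, but by the triangle inequality they are
  both far from many common columns, through which their values can be compared.
\<close>

lemma sum_col_dist_diff_ge:
  assumes A: "A \<in> regular_mats n d" and d: "2 * d \<le> n"
    and x: "(\<Sum>j<n. x j) = 0" "(\<Sum>j<n. (x j)\<^sup>2) = 1"
  shows "real n * (real d)\<^sup>2 / 48 \<le> (\<Sum>j<n. \<Sum>k<n. (col_dist n A j k)\<^sup>2 * (x j - x k)\<^sup>2)"
    (is "_ \<le> ?H")
proof -
  let ?D = "col_dist n A"
  have n: "real n > 0" using x(2) by (cases "n = 0") auto
  have "real n * (real d)\<^sup>2 / 4 * (2 * n) = (\<Sum>j<n. \<Sum>k<n. (x j - x k)\<^sup>2 * (real n * (real d)\<^sup>2 / 4))"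
    using sum_square_diff[of x n] unfolding x sum_distrib_right[symmetric] by simp
  also have "\<dots> \<le> (\<Sum>j<n. \<Sum>k<n. (x j - x k)\<^sup>2 * (\<Sum>l<n. (?D j l)\<^sup>2))"
    using sum_col_dist_square_ge[OF A _ d] by (intro sum_mono mult_left_mono) auto
  also have "\<dots> = (\<Sum>j<n. \<Sum>k<n. \<Sum>l<n. (x j - x k)\<^sup>2 * (?D j l)\<^sup>2)"
    by (simp add: sum_distrib_left)
  also have "\<dots> \<le> (\<Sum>j<n. \<Sum>k<n. \<Sum>l<n. 8 * ((?D j k)\<^sup>2 * (x j - x k)\<^sup>2
      + (?D j l)\<^sup>2 * (x j - x l)\<^sup>2 + (?D k l)\<^sup>2 * (x k - x l)\<^sup>2))"
    by (intro sum_mono three_point_bound)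
       (auto intro: col_dist_nonneg[OF A] col_dist_triangle[OF A])
  also have "\<dots> = 8 * ((\<Sum>j<n. \<Sum>k<n. \<Sum>l<n. (?D j k)\<^sup>2 * (x j - x k)\<^sup>2)
      + (\<Sum>j<n. \<Sum>k<n. \<Sum>l<n. (?D j l)\<^sup>2 * (x j - x l)\<^sup>2)
      + (\<Sum>j<n. \<Sum>k<n. \<Sum>l<n. (?D k l)\<^sup>2 * (x k - x l)\<^sup>2))"
    by (simp only: sum_distrib_left[symmetric] sum.distrib)
  \<comment> \<open>In each triple sum one index is free and contributes a factor
    \<open>n\<close>.\<close>
  also have "\<dots> = 24 * (n * ?H)"
    by (simp add: sum_distrib_left[symmetric])
  finally have "real n * (real n * (real d)\<^sup>2 / 48) \<le> real n * ?H" by (simp add: algebra_simps)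
  then show ?thesis using n by simp
qed

text \<open>Exchanging the sums reduces this to counting, for two given columns, the pairs of rows
  on which they are switchable.\<close>

lemma sum_switch_energy_ge:
  assumes A: "A \<in> regular_mats n d" and d: "2 * d \<le> n"
    and x: "(\<Sum>j<n. x j) = 0" "(\<Sum>j<n. (x j)\<^sup>2) = 1"
  shows "(real d)\<^sup>2 / 48 \<le> (\<Sum>i<n. \<Sum>i'<n. switch_energy n x A i i')"
proof -
  let ?D = "col_dist n A"
  have n: "real n > 0" using x(2) by (cases "n = 0") auto
  \<comment> \<open>One row must read (1, 0) and the other (0, 1) in the two columns. There are
    \<open>?D j k\<close> and \<open>?D k j\<close> such rows, equal numbers by symmetry, and two
    orders.\<close>
  have sw: "(\<Sum>i<n. \<Sum>i'<n. if switchable A i i' j k then 1 else 0 :: real) = 2 * (?D j k)\<^sup>2"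
    if "j < n" "k < n" for j k
  proof -
    let ?u = "\<lambda>i. A $$ (i, j) * (1 - A $$ (i, k))" and ?v = "\<lambda>i. A $$ (i, k) * (1 - A $$ (i, j))"
    have "(\<Sum>i<n. \<Sum>i'<n. if switchable A i i' j k then 1 else 0 :: real)
        = (\<Sum>i<n. \<Sum>i'<n. ?u i * ?v i' + ?v i * ?u i')"
    proof (intro sum.cong refl)
      fix i i' assume "i \<in> {..<n}" "i' \<in> {..<n}"
      then show "(if switchable A i i' j k then 1 else 0 :: real) = ?u i * ?v i' + ?v i * ?u i'"
        using regular_mats_entry[OF A, of i j] regular_mats_entry[OF A, of i k]
          regular_mats_entry[OF A, of i' j] regular_mats_entry[OF A, of i' k] that
        by (auto simp: switchable_def)
    qed
    also have "\<dots> = ?D j k * ?D k j + ?D k j * ?D j k"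
      by (simp only: sum.distrib col_dist_def sum_product)
    finally show ?thesis
      using col_dist_commute[OF A that] by (simp add: power2_eq_square)
  qed
  have "(\<Sum>i<n. \<Sum>i'<n. switch_energy n x A i i')
      = (\<Sum>i<n. \<Sum>i'<n. \<Sum>j<n. \<Sum>k<n. if switchable A i i' j k then (x j - x k)\<^sup>2 else 0) / (2 * n)"
    by (simp add: switch_energy_def sum_divide_distrib)
  also have "(\<Sum>i<n. \<Sum>i'<n. \<Sum>j<n. \<Sum>k<n. if switchable A i i' j k then (x j - x k)\<^sup>2 else 0)
      = (\<Sum>i<n. \<Sum>j<n. \<Sum>i'<n. \<Sum>k<n. if switchable A i i' j k then (x j - x k)\<^sup>2 else 0)"
    by (intro sum.cong refl sum.swap)
  also have "\<dots> = (\<Sum>j<n. \<Sum>i<n. \<Sum>i'<n. \<Sum>k<n. if switchable A i i' j k then (x j - x k)\<^sup>2 else 0)"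
    by (rule sum.swap)
  also have "\<dots> = (\<Sum>j<n. \<Sum>i<n. \<Sum>k<n. \<Sum>i'<n. if switchable A i i' j k then (x j - x k)\<^sup>2 else 0)"
    by (intro sum.cong refl sum.swap)
  also have "\<dots> = (\<Sum>j<n. \<Sum>k<n. \<Sum>i<n. \<Sum>i'<n. if switchable A i i' j k then (x j - x k)\<^sup>2 else 0)"
    by (intro sum.cong refl sum.swap)
  also have "\<dots> = (\<Sum>j<n. \<Sum>k<n. 2 * ((?D j k)\<^sup>2 * (x j - x k)\<^sup>2))"
  proof (intro sum.cong refl)
    fix j k assume "j \<in> {..<n}" "k \<in> {..<n}"
    then have jk: "j < n" "k < n" by auto
    have "(\<Sum>i<n. \<Sum>i'<n. if switchable A i i' j k then (x j - x k)\<^sup>2 else 0)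
        = (x j - x k)\<^sup>2 * (\<Sum>i<n. \<Sum>i'<n. if switchable A i i' j k then 1 else 0)"
      by (simp add: sum_distrib_left if_distrib cong: if_cong)
    then show "(\<Sum>i<n. \<Sum>i'<n. if switchable A i i' j k then (x j - x k)\<^sup>2 else 0)
        = 2 * ((?D j k)\<^sup>2 * (x j - x k)\<^sup>2)" by (simp add: sw[OF jk])
  qed
  also have "\<dots> / (2 * n) = (\<Sum>j<n. \<Sum>k<n. (?D j k)\<^sup>2 * (x j - x k)\<^sup>2) / n"
    by (simp add: sum_distrib_left[symmetric])
  finally show ?thesis
    using sum_col_dist_diff_ge[OF A d x] n by (simp add: pos_le_divide_eq mult.commute)
qed

lemma switch_energy_refl: "switch_energy n x A i i = 0"
  by (simp add: switch_energy_def switchable_def)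

text \<open>At most \<open>2 * n * (n - card R)\<close> pairs leave \<open>R \<times> R\<close>,
  each of energy at most 1, so the assumption on \<open>card R\<close> makes their share at most
  half of the total bound. Diagonal pairs have energy 0.\<close>

lemma sum_switch_energy_distinct_ge:
  assumes A: "A \<in> regular_mats n d" and d: "2 * d \<le> n"
    and x: "(\<Sum>j<n. x j) = 0" "(\<Sum>j<n. (x j)\<^sup>2) = 1"
    and R: "R \<subseteq> {..<n}" "192 * real n * (real n - real (card R)) \<le> (real d)\<^sup>2"
  shows "(real d)\<^sup>2 / 96 \<le> (\<Sum>(i, i')\<in>{(i, i'). i \<in> R \<and> i' \<in> R \<and> i \<noteq> i'}. switch_energy n x A i i')"
proof -
  let ?N = "{..<n} \<times> {..<n}" and ?e = "\<lambda>(i, i'). switch_energy n x A i i'"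
  have fin: "finite R" using R(1) finite_subset by blast
  have RN: "R \<times> R \<subseteq> ?N" using R(1) by auto
  have cR: "card R \<le> n" using card_mono[OF _ R(1)] by simp
  have "(real d)\<^sup>2 / 48 \<le> sum ?e ?N"
    using sum_switch_energy_ge[OF A d x] by (simp add: sum.cartesian_product)
  also have "\<dots> = sum ?e (?N - R \<times> R) + sum ?e (R \<times> R)"
    by (rule sum.subset_diff[OF RN]) simp
  also have "sum ?e (R \<times> R) = sum ?e {(i, i'). i \<in> R \<and> i' \<in> R \<and> i \<noteq> i'}"
    using fin by (intro sum.mono_neutral_right) (auto simp: switch_energy_refl)
  also have "sum ?e (?N - R \<times> R) \<le> real (card (?N - R \<times> R)) * 1"
    using x by (intro sum_bounded_above) (auto intro: switch_energy_le_1)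
  also have "real (card (?N - R \<times> R)) = real n * real n - real (card R) * real (card R)"
  proof -
    have "card (?N - R \<times> R) = n * n - card R * card R"
      using fin by (subst card_Diff_subset[OF _ RN]) auto
    then show ?thesis using mult_le_mono[OF cR cR] by (simp add: of_nat_diff)
  qed
  also have "(real n * real n - real (card R) * real (card R)) * 1 \<le> (real d)\<^sup>2 / 96"
  proof -
    have "real n * real n - real (card R) * real (card R)
        = (real n + real (card R)) * (real n - real (card R))" by (simp add: algebra_simps)
    also have "\<dots> \<le> (2 * real n) * (real n - real (card R))"
      using cR by (intro mult_right_mono) auto
    finally show ?thesis using R(2) by simp
  qed
  finally show ?thesis by simp
qed


section \<open>Iterating the switching step\<close>

text \<open>The function \<open>G\<close> carries the factors from row pairs already treated. It
  depends only on rows outside \<open>R\<close>, so switchings within \<open>R\<close> fix it. Each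
  round removes two rows, which keeps \<open>n - card R + 2 * t\<close> constant along the
  induction. The rate comes from \<open>24576 = 96 * 256\<close>.\<close>

lemma sum_exp_rows_le:
  fixes x :: "nat \<Rightarrow> real"
  assumes d: "2 * d \<le> n" and x: "(\<Sum>j<n. x j) = 0" "(\<Sum>j<n. (x j)\<^sup>2) = 1"
    and "R \<subseteq> {..<n}"
    and "192 * real n * (real n - real (card R) + 2 * real t) \<le> (real d)\<^sup>2"
    and "\<And>A. A \<in> regular_mats n d \<Longrightarrow> 0 \<le> G A"
    and "\<And>A B. A \<in> regular_mats n d \<Longrightarrow> B \<in> regular_mats n d \<Longrightarrow>
      (\<And>i j. i < n \<Longrightarrow> i \<notin> R \<Longrightarrow> j < n \<Longrightarrow> A $$ (i, j) = B $$ (i, j)) \<Longrightarrow> G A = G B"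
  shows "(\<Sum>A\<in>regular_mats n d. exp (- (\<Sum>i\<in>R. (row_form n x A i)\<^sup>2)) * G A)
    \<le> (1 - (real d / real n)\<^sup>2 / 24576) ^ t * (\<Sum>A\<in>regular_mats n d. G A)"
  using assms(4-)
proof (induction t arbitrary: R G)
  case 0
  have "exp (- (\<Sum>i\<in>R. (row_form n x A i)\<^sup>2)) * G A \<le> 1 * G A" if "A \<in> regular_mats n d" for A
    using that by (intro mult_right_mono 0) (auto intro: sum_nonneg)
  then show ?case by (simp add: sum_mono)
next
  case (Suc t)
  let ?M = "regular_mats n d" and ?k = "1 - (real d / real n)\<^sup>2 / 24576"
  let ?e = "\<lambda>A i i'. switch_energy n x A i i'"
  let ?S = "\<Sum>A\<in>?M. exp (- (\<Sum>i\<in>R. (row_form n x A i)\<^sup>2)) * G A"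
  define Q where "Q = {(i, i'). i \<in> R \<and> i' \<in> R \<and> i \<noteq> i'}"
  have n: "n > 0" using x(2) by (cases "n = 0") auto
  have fin: "finite R" using Suc.prems(1) finite_subset by blast
  have QR: "Q \<subseteq> {..<n} \<times> {..<n}" using Suc.prems(1) by (auto simp: Q_def)
  then have finQ: "finite Q" using finite_subset by blast
  have cR: "card R \<le> n" using card_mono[OF _ Suc.prems(1)] by simp
  have e1: "?e A i i' \<le> 1" for A i i' using x by (intro switch_energy_le_1) simp
  have "(real d / real n)\<^sup>2 \<le> 1" using d n by (simp add: power_le_one)
  then have k0: "0 \<le> ?k" by simp
  have step: "?S \<le> ?k ^ t * (\<Sum>A\<in>?M. (1 - ?e A i i' / 256) * G A)" if "(i, i') \<in> Q" for i i'
  proof -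
    have i: "i \<in> R" "i' \<in> R" "i \<noteq> i'" "i < n" "i' < n"
      using that QR by (auto simp: Q_def)
    define R' where "R' = R - {i, i'}"
    define H where "H A = exp (- (\<Sum>r\<in>R'. (row_form n x A r)\<^sup>2))" for A
    \<comment> \<open>The energy depends only on rows \<open>i\<close> and \<open>i'\<close>, which
      lie outside \<open>R'\<close>, so \<open>G'\<close> is admissible for the induction
      hypothesis.\<close>
    define G' where "G' A = (1 - ?e A i i' / 256) * G A" for A
    \<comment> \<open>The factor of row \<open>i'\<close> is dropped, since a switching alters that
      row too.\<close>
    have "?S \<le> (\<Sum>A\<in>?M. exp (- (row_form n x A i)\<^sup>2) * (H A * G A))"
    proof (intro sum_mono)
      fix A assume A: "A \<in> ?M"
      have "(\<Sum>r\<in>insert i R'. (row_form n x A r)\<^sup>2) \<le> (\<Sum>r\<in>R. (row_form n x A r)\<^sup>2)"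
        using fin i by (intro sum_mono2) (auto simp: R'_def)
      moreover have "(\<Sum>r\<in>insert i R'. (row_form n x A r)\<^sup>2)
          = (row_form n x A i)\<^sup>2 + (\<Sum>r\<in>R'. (row_form n x A r)\<^sup>2)"
        using fin by (simp add: R'_def)
      ultimately have "exp (- (\<Sum>r\<in>R. (row_form n x A r)\<^sup>2)) \<le> exp (- (row_form n x A i)\<^sup>2) * H A"
        unfolding H_def exp_add[symmetric] by simp
      then show "exp (- (\<Sum>r\<in>R. (row_form n x A r)\<^sup>2)) * G A
          \<le> exp (- (row_form n x A i)\<^sup>2) * (H A * G A)"
        using Suc.prems(3)[OF A] by (simp add: mult_right_mono mult.assoc[symmetric])
    qed
    also have "\<dots> \<le> (\<Sum>A\<in>?M. (1 - ?e A i i' / 256) * (H A * G A))"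
    proof (intro sum_exp_row_form_le i)
      show "0 \<le> H A * G A" if "A \<in> ?M" for A
        using Suc.prems(3)[OF that] by (simp add: H_def)
      fix p E A assume p: "involution_below n p" and A: "A \<in> ?M"
      let ?B = "switch n p i i' E A"
      have eq: "?B $$ (r, j) = A $$ (r, j)" if "r < n" "j < n" "r \<notin> {i, i'}" for r j
        using that by (auto simp: switch_index)
      have "row_form n x ?B r = row_form n x A r" if "r \<in> R'" for r
        unfolding row_form_def using that Suc.prems(1)
        by (intro sum.cong refl) (auto simp: R'_def eq)
      then have "H ?B = H A" by (simp add: H_def)
      moreover have "G ?B = G A"
        using i by (intro Suc.prems(4) switch_in_regular_mats A p) (auto intro!: eq)
      ultimately show "H ?B * G ?B = H A * G A" by simp
    qed (use x in simp)
    also have "\<dots> = (\<Sum>A\<in>?M. exp (- (\<Sum>r\<in>R'. (row_form n x A r)\<^sup>2)) * G' A)"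
      by (simp add: H_def G'_def mult_ac)
    also have "\<dots> \<le> ?k ^ t * (\<Sum>A\<in>?M. G' A)"
    proof (rule Suc.IH)
      show "R' \<subseteq> {..<n}" using Suc.prems(1) by (auto simp: R'_def)
      have "{i, i'} \<subseteq> R" "card {i, i'} = 2" using i by auto
      then have "card R' = card R - 2" "2 \<le> card R"
        using fin card_mono[of R "{i, i'}"] by (simp_all add: R'_def card_Diff_subset)
      then show "192 * real n * (real n - real (card R') + 2 * real t) \<le> (real d)\<^sup>2"
        using Suc.prems(2) by (simp add: of_nat_diff algebra_simps)
      show "0 \<le> G' A" if "A \<in> ?M" for A
        using Suc.prems(3)[OF that] e1[of A i i'] by (simp add: G'_def)
      fix A B assume A: "A \<in> ?M" and B: "B \<in> ?M"
        and eq: "\<And>r j. r < n \<Longrightarrow> r \<notin> R' \<Longrightarrow> j < n \<Longrightarrow> A $$ (r, j) = B $$ (r, j)"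
      have "switchable A i i' j k \<longleftrightarrow> switchable B i i' j k" if "j < n" "k < n" for j k
        using that i by (simp add: switchable_def eq R'_def)
      then have "?e A i i' = ?e B i i'"
        unfolding switch_energy_def
        by (intro arg_cong2[where f = "(/)"] sum.cong refl) auto
      moreover have "G A = G B" using eq by (intro Suc.prems(4) A B) (auto simp: R'_def)
      ultimately show "G' A = G' B" by (simp add: G'_def)
    qed
    finally show ?thesis by (simp add: G'_def)
  qed
  have "0 \<le> 192 * real n * (real n - real (card R))" using cR by simp
  moreover have "192 * real n * (real n - real (card R)) + 384 * real n * (real t + 1) \<le> (real d)\<^sup>2"
    using Suc.prems(2) by (simp add: algebra_simps)
  moreover have "0 < 384 * real n * (real t + 1)" using n by simp
  ultimately have cond: "192 * real n * (real n - real (card R)) \<le> (real d)\<^sup>2" "0 < (real d)\<^sup>2"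
    by linarith+
  have Qe: "(real d)\<^sup>2 / 96 \<le> (\<Sum>(i, i')\<in>Q. ?e A i i')" if "A \<in> ?M" for A
    unfolding Q_def by (rule sum_switch_energy_distinct_ge[OF that d x Suc.prems(1) cond(1)])
  have "d \<le> n" using d by simp
  then obtain A0 where "A0 \<in> ?M" using regular_mats_nonempty by blast
  then have "Q \<noteq> {}" using Qe[of A0] cond(2) by auto
  then have cQ: "0 < real (card Q)" using finQ by (simp add: card_gt_0_iff)
  have "real (card Q) \<le> real n * real n"
    using card_mono[OF _ QR] by (simp flip: of_nat_mult)
  then have "real (card Q) * (real d / real n)\<^sup>2 \<le> (real n * real n) * (real d / real n)\<^sup>2"
    by (intro mult_right_mono) auto
  then have cQd: "real (card Q) * (real d / real n)\<^sup>2 \<le> (real d)\<^sup>2"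
    using n by (simp add: power2_eq_square)
  \<comment> \<open>No single pair need have large energy for all \<open>A\<close>. Averaging over
    \<open>Q\<close> and exchanging the sums gives every \<open>A\<close> its mean energy, at least
    \<open>(d / n)\<^sup>2 / 96\<close> because \<open>Q\<close> has at most \<open>n * n\<close>
    elements.\<close>
  have "real (card Q) * ?S = (\<Sum>(i, i')\<in>Q. ?S)" by (simp add: case_prod_unfold)
  also have "\<dots> \<le> (\<Sum>(i, i')\<in>Q. ?k ^ t * (\<Sum>A\<in>?M. (1 - ?e A i i' / 256) * G A))"
    by (intro sum_mono) (use step in auto)
  also have "\<dots> = ?k ^ t * (\<Sum>q\<in>Q. \<Sum>A\<in>?M. (1 - ?e A (fst q) (snd q) / 256) * G A)"
    by (simp add: case_prod_unfold sum_distrib_left)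
  also have "\<dots> = ?k ^ t * (\<Sum>A\<in>?M. (\<Sum>q\<in>Q. 1 - ?e A (fst q) (snd q) / 256) * G A)"
    by (subst sum.swap) (simp add: sum_distrib_right)
  also have "\<dots> \<le> ?k ^ t * (\<Sum>A\<in>?M. real (card Q) * ?k * G A)"
  proof (intro mult_left_mono sum_mono mult_right_mono Suc.prems(3))
    fix A assume A: "A \<in> ?M"
    have "(\<Sum>q\<in>Q. 1 - ?e A (fst q) (snd q) / 256)
        = real (card Q) - (\<Sum>(i, i')\<in>Q. ?e A i i') / 256"
      by (simp add: sum_subtractf sum_divide_distrib case_prod_unfold)
    also have "\<dots> \<le> real (card Q) - (real (card Q) * (real d / real n)\<^sup>2 / 96) / 256"
      using Qe[OF A] cQd by simp
    also have "\<dots> = real (card Q) * ?k" by (simp add: algebra_simps)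
    finally show "(\<Sum>q\<in>Q. 1 - ?e A (fst q) (snd q) / 256) \<le> real (card Q) * ?k" .
  qed (use k0 in auto)
  also have "\<dots> = real (card Q) * (?k ^ Suc t * (\<Sum>A\<in>?M. G A))"
    by (simp add: sum_distrib_left[symmetric])
  finally show ?case using cQ by (simp only: mult_le_cancel_left_pos)
qed

section \<open>Markov's inequality and the choice of constants\<close>

theorem lemma2p18:
  fixes lam :: real
  assumes "0 < lam" and "lam \<le> 1 / 2"
  shows "\<exists>c>0. \<forall>n d :: nat. n > 0 \<longrightarrow> real d = lam * real n \<longrightarrow>
    (SUP x\<in>sphere0 n. measure_pmf.prob (pmf_of_set (regular_mats n d))
        {A. norm2_vec (A *\<^sub>v x) \<le> c * sqrt (real n)})
      \<le> 2 * exp (- c * real n)"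
proof -
  \<comment> \<open>With \<open>d / n = lam\<close>, each round gains the factor
    \<open>1 - \<beta>\<close>. About \<open>lam\<^sup>2 * n / 384\<close> rounds yield the exponent
    \<open>2 * c * n\<close>; Markov's inequality costs \<open>c\<^sup>2 * n\<close>, at most half
    of it as \<open>c \<le> 1\<close>.\<close>
  define \<beta> where "\<beta> = lam\<^sup>2 / 24576"
  define c where "c = \<beta> * lam\<^sup>2 / 768"
  have lam2: "0 < lam\<^sup>2" "lam\<^sup>2 \<le> 1" using assms by (auto intro: power_le_one)
  have \<beta>: "0 < \<beta>" "\<beta> \<le> 1 / 2" using lam2 by (auto simp: \<beta>_def)
  have c: "0 < c" "c \<le> 1"
    using lam2 \<beta> mult_mono[of \<beta> 1 "lam\<^sup>2" 1] by (auto simp: c_def)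
  have "(SUP x\<in>sphere0 n. measure_pmf.prob (pmf_of_set (regular_mats n d))
        {A. norm2_vec (A *\<^sub>v x) \<le> c * sqrt (real n)}) \<le> 2 * exp (- c * real n)"
    if n: "n > 0" and dn: "real d = lam * real n" for n d
  proof (rule cSUP_least)
    \<comment> \<open>The supremum is not over the empty set: \<open>d > 0\<close> and
      \<open>2 * d \<le> n\<close> exclude \<open>n = 1\<close>, where \<open>sphere0 n\<close> is
      empty.\<close>
    have "real d > 0" using n dn assms by simp
    moreover have "lam * real n \<le> 1 / 2 * real n" using assms by (intro mult_right_mono) auto
    then have d2: "2 * d \<le> n" using dn by linarith
    ultimately have "2 \<le> n" by simp
    then show "sphere0 n \<noteq> {}" by (rule sphere0_nonempty)
    fix v assume "v \<in> sphere0 n"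
    then have v: "dim_vec v = n" "norm2_vec v = 1" "(\<Sum>i<n. v $ i) = 0"
      by (auto simp: sphere0_def)
    define x where "x j = v $ j" for j
    have x: "(\<Sum>j<n. x j) = 0" "(\<Sum>j<n. (x j)\<^sup>2) = 1"
      using v by (auto simp: x_def norm2_vec_def L2_set_def)
    let ?M = "regular_mats n d" and ?q = "\<lambda>A. \<Sum>i<n. (row_form n x A i)\<^sup>2"
    define S where "S = ?M \<inter> {A. norm2_vec (A *\<^sub>v v) \<le> c * sqrt (real n)}"
    define t where "t = nat \<lfloor>lam\<^sup>2 * real n / 384\<rfloor>"
    have t: "real t \<le> lam\<^sup>2 * real n / 384" "lam\<^sup>2 * real n / 384 - 1 \<le> real t"
      using lam2 unfolding t_def by (simp_all add: of_nat_nat, linarith+)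
    have M: "?M \<noteq> {}" "finite ?M"
      using d2 regular_mats_nonempty[of d n] finite_regular_mats by auto
    have q: "?q A \<le> c\<^sup>2 * n" if "A \<in> S" for A
    proof -
      have A: "A \<in> carrier_mat n n" "norm2_vec (A *\<^sub>v v) \<le> c * sqrt (real n)"
        using that by (auto simp: S_def regular_mats_def)
      have "(A *\<^sub>v v) $ i = row_form n x A i" if "i < n" for i
        using that A(1) v(1)
        by (auto simp: row_form_def x_def scalar_prod_def lessThan_atLeast0 intro!: sum.cong)
      then have "norm2_vec (A *\<^sub>v v) = sqrt (?q A)"
        using A(1) by (simp add: norm2_vec_def L2_set_def)
      with A(2) have "sqrt (?q A) \<le> c * sqrt (real n)" by simp
      then have "(sqrt (?q A))\<^sup>2 \<le> (c * sqrt (real n))\<^sup>2"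
        by (intro power_mono) (auto intro: sum_nonneg)
      then show ?thesis by (simp add: power_mult_distrib sum_nonneg)
    qed
    have "real (card S) * exp (- (c\<^sup>2 * n)) = (\<Sum>A\<in>S. exp (- (c\<^sup>2 * n)))" by simp
    also have "\<dots> \<le> (\<Sum>A\<in>S. exp (- ?q A))" using q by (intro sum_mono) simp
    also have "\<dots> \<le> (\<Sum>A\<in>?M. exp (- ?q A))" using M by (intro sum_mono2) (auto simp: S_def)
    also have "\<dots> = (\<Sum>A\<in>?M. exp (- ?q A) * 1)" by simp
    also have "\<dots> \<le> (1 - (real d / real n)\<^sup>2 / 24576) ^ t * (\<Sum>A\<in>?M. 1)"
    proof (rule sum_exp_rows_le[OF d2 x])
      have "384 * real n * real t \<le> 384 * real n * (lam\<^sup>2 * real n / 384)"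
        using t(1) by (intro mult_left_mono) auto
      also have "\<dots> = (real d)\<^sup>2" by (simp add: dn power2_eq_square)
      finally show "192 * real n * (real n - real (card {..<n}) + 2 * real t) \<le> (real d)\<^sup>2"
        by simp
    qed auto
    also have "\<dots> = (1 - \<beta>) ^ t * card ?M" using n by (simp add: dn \<beta>_def)
    also have "\<dots> \<le> 2 * exp (- (2 * c * n)) * card ?M"
    proof (intro mult_right_mono)
      have "(1 - \<beta>) ^ t \<le> exp (- \<beta>) ^ t"
        using \<beta> exp_ge_add_one_self[of "- \<beta>"] by (intro power_mono) auto
      also have "\<dots> = exp (- (\<beta> * real t))" by (simp add: exp_of_nat_mult[symmetric] mult.commute)
      also have "\<dots> \<le> exp (\<beta> + - (2 * c * n))"
        using mult_left_mono[OF t(2), of \<beta>] \<beta> by (simp add: c_def algebra_simps)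
      also have "\<dots> = exp \<beta> * exp (- (2 * c * n))" by (rule exp_add)
      also have "\<dots> \<le> 2 * exp (- (2 * c * n))"
      proof (intro mult_right_mono)
        have "exp \<beta> \<le> exp (1 / 2)" using \<beta> by simp
        then show "exp \<beta> \<le> 2" using exp_half_le2 by (rule order_trans)
      qed simp
      finally show "(1 - \<beta>) ^ t \<le> 2 * exp (- (2 * c * n))" .
    qed simp
    finally have "real (card S) * exp (- (c\<^sup>2 * n)) \<le> 2 * exp (- (2 * c * n)) * card ?M" .
    then have "real (card S) * exp (- (c\<^sup>2 * n)) * exp (c\<^sup>2 * n)
        \<le> 2 * exp (- (2 * c * n)) * card ?M * exp (c\<^sup>2 * n)"
      by (intro mult_right_mono) auto
    then have "real (card S) \<le> 2 * exp (c\<^sup>2 * n + - (2 * c * n)) * card ?M"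
      unfolding exp_add by (simp add: exp_minus mult_ac)
    also have "\<dots> \<le> 2 * exp (- c * n) * card ?M"
    proof (intro mult_right_mono mult_left_mono)
      have "c * c * n \<le> 1 * c * n" using c by (intro mult_right_mono) auto
      then show "exp (c\<^sup>2 * n + - (2 * c * n)) \<le> exp (- c * n)"
        by (simp add: power2_eq_square)
    qed auto
    finally have "card S / card ?M \<le> 2 * exp (- c * real n)"
      using M by (simp add: pos_divide_le_eq card_gt_0_iff)
    then show "measure_pmf.prob (pmf_of_set ?M) {A. norm2_vec (A *\<^sub>v v) \<le> c * sqrt (real n)}
        \<le> 2 * exp (- c * real n)"
      using M by (simp add: measure_pmf_of_set S_def)
  qed
  with c(1) show ?thesis by blast
qed

end
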